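(* Let $G$ be a group, $M=G^0=G\sqcup\{0\}$ the monoid obtained from $G$ by adjoining a zero element, and $\alpha$ a strong partial action of $M$ on a semigroup $X$. Then the elements of $X_M$ (i.e. the $\approx$-equivalence classes of $M\times X$) are exactly the following classes: \begin{align*} [0,x]&=\{(0,\alpha_g(x)) : g\in G,\ x\in\operatorname{dom}\alpha_g\}, && \text{if } x\notin\operatorname{dom}\alpha_0,\\ [g,x]&=\{(h,y) : h\in G,\ x\in\operatorname{dom}\alpha_{h^{-1}g},\ \alpha_{h^{-1}g}(x)=y\}, && \text{if } g\in G,\ x\notin\operatorname{im}\alpha_0,\\ [g,x]&=(G\times\{x\})\sqcup(\{0\}\times\alpha_0^{-1}(x)), && \text{if } g\in G,\ x\in\operatorname{im}\alpha_0. \end{align*}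
   Context: Let $M$ be a monoid with identity $e$. A strong partial action of $M$ on a set $X$ is a family $\alpha=\{\alpha_m:\operatorname{dom}\alpha_m\to X\}_{m\in M}$ of maps with $\operatorname{dom}\alpha_m\subseteq X$ such that: (1) $\operatorname{dom}\alpha_e=X$ and $\alpha_e=\mathrm{id}_X$; (2) $\alpha_m^{-1}(\operatorname{dom}\alpha_n)=\operatorname{dom}\alpha_{nm}\cap\operatorname{dom}\alpha_m$ for all $m,n\in M$; (3) $\alpha_n\circ\alpha_m=\alpha_{nm}$ on $\alpha_m^{-1}(\operatorname{dom}\alpha_n)$ for all $m,n\in M$. A strong partial action of $M$ on a semigroup $X$ is one on the underlying set such that each $\operatorname{dom}\alpha_m$ is a (possibly empty) subsemigroup of $X$ and each $\alpha_m$ is a semigroup homomorphism. Write $\operatorname{im}\alpha_m=\alpha_m(\operatorname{dom}\alpha_m)$ and $\alpha_0^{-1}(x)=\{y\in\operatorname{dom}\alpha_0:\alpha_0(y)=x\}$. $X_M=(M\times X)/{\approx}$, where $\approx$ is the equivalence relation generated by: $(m,x)\rightharpoonup(n,y)$ iff there is $k\in M$ with $m=nk$, $x\in\operatorname{dom}\alpha_k$ and $y=\alpha_k(x)$. The $\approx$-class of $(m,x)$ is denoted $[m,x]$. *)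

theory Defs
  imports "HOL-Algebra.Group"
begin

text \<open>
  Semigroups are rendered as structures with a carrier and a multiplication. The record type is
  that of monoids, so that the homomorphism sets \<^const>\<open>hom\<close> of the library apply; its field for the
  unit is never used. The carrier may be empty.
\<close>

locale semigroup_struct =
  fixes X (structure)
  assumes mult_closed: "\<lbrakk>x \<in> carrier X; y \<in> carrier X\<rbrakk> \<Longrightarrow> x \<otimes> y \<in> carrier X"
    and mult_assoc: "\<lbrakk>x \<in> carrier X; y \<in> carrier X; z \<in> carrier X\<rbrakk> \<Longrightarrow> (x \<otimes> y) \<otimes> z = x \<otimes> (y \<otimes> z)"

definition subsemigroup :: "'x set \<Rightarrow> ('x, 'c) monoid_scheme \<Rightarrow> bool" where
  "subsemigroup H X \<longleftrightarrow>
     H \<subseteq> carrier X \<and> (\<forall>x\<in>H. \<forall>y\<in>H. x \<otimes>\<^bsub>X\<^esub> y \<in> H)"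

text \<open>
  The partial map \<open>\<alpha> m\<close> is represented by a total function together with its domain \<open>D m\<close>; the
  values of \<open>\<alpha> m\<close> outside \<open>D m\<close> are irrelevant.
\<close>

locale strong_partial_action = monoid M
  for M :: "('m, 'b) monoid_scheme"
    and X :: "'x set"
    and D :: "'m \<Rightarrow> 'x set"
    and \<alpha> :: "'m \<Rightarrow> 'x \<Rightarrow> 'x" +
  assumes dom_subset: "m \<in> carrier M \<Longrightarrow> D m \<subseteq> X"
    and maps_to: "m \<in> carrier M \<Longrightarrow> \<alpha> m \<in> D m \<rightarrow> X"
    and dom_one: "D \<one>\<^bsub>M\<^esub> = X"
    and act_one: "x \<in> X \<Longrightarrow> \<alpha> \<one>\<^bsub>M\<^esub> x = x"
    and preimage_dom:
      "\<lbrakk>m \<in> carrier M; n \<in> carrier M\<rbrakk> \<Longrightarrow>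
         {x \<in> D m. \<alpha> m x \<in> D n} = D (n \<otimes>\<^bsub>M\<^esub> m) \<inter> D m"
    and act_mult:
      "\<lbrakk>m \<in> carrier M; n \<in> carrier M; x \<in> D m; \<alpha> m x \<in> D n\<rbrakk> \<Longrightarrow>
         \<alpha> n (\<alpha> m x) = \<alpha> (n \<otimes>\<^bsub>M\<^esub> m) x"

locale semigroup_strong_partial_action =
  strong_partial_action M "carrier X" D \<alpha> + semigroup_struct X
  for M :: "('m, 'b) monoid_scheme"
    and X :: "('x, 'c) monoid_scheme"
    and D :: "'m \<Rightarrow> 'x set"
    and \<alpha> :: "'m \<Rightarrow> 'x \<Rightarrow> 'x" +
  assumes dom_subsemigroup: "m \<in> carrier M \<Longrightarrow> subsemigroup (D m) X"
    and act_hom: "m \<in> carrier M \<Longrightarrow> \<alpha> m \<in> hom (X\<lparr>carrier := D m\<rparr>) X"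

definition glob_step ::
    "('m, 'b) monoid_scheme \<Rightarrow> 'x set \<Rightarrow> ('m \<Rightarrow> 'x set) \<Rightarrow> ('m \<Rightarrow> 'x \<Rightarrow> 'x) \<Rightarrow>
     'm \<times> 'x \<Rightarrow> 'm \<times> 'x \<Rightarrow> bool" where
  "glob_step M X D \<alpha> p q \<longleftrightarrow>
     p \<in> carrier M \<times> X \<and> q \<in> carrier M \<times> X \<and>
     (\<exists>k\<in>carrier M. fst p = fst q \<otimes>\<^bsub>M\<^esub> k \<and> snd p \<in> D k \<and> snd q = \<alpha> k (snd p))"

definition glob_rel ::
    "('m, 'b) monoid_scheme \<Rightarrow> 'x set \<Rightarrow> ('m \<Rightarrow> 'x set) \<Rightarrow> ('m \<Rightarrow> 'x \<Rightarrow> 'x) \<Rightarrow>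
     (('m \<times> 'x) \<times> ('m \<times> 'x)) set" where
  "glob_rel M X D \<alpha> =
     {(p, q). p \<in> carrier M \<times> X \<and> q \<in> carrier M \<times> X \<and> equivclp (glob_step M X D \<alpha>) p q}"

lemma equiv_glob_rel: "equiv (carrier M \<times> X) (glob_rel M X D \<alpha>)"
proof (rule equivI)
  show "refl_on (carrier M \<times> X) (glob_rel M X D \<alpha>)"
    by (auto simp: refl_on_def glob_rel_def)
  show "sym (glob_rel M X D \<alpha>)"
    by (auto simp: sym_def glob_rel_def intro: equivclp_sym)
  show "trans (glob_rel M X D \<alpha>)"
    by (auto simp: trans_def glob_rel_def intro: equivclp_trans)
  show "glob_rel M X D \<alpha> \<subseteq> (carrier M \<times> X) \<times> (carrier M \<times> X)"
    by (auto simp: glob_rel_def)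
qed

definition glob_class ::
    "('m, 'b) monoid_scheme \<Rightarrow> 'x set \<Rightarrow> ('m \<Rightarrow> 'x set) \<Rightarrow> ('m \<Rightarrow> 'x \<Rightarrow> 'x) \<Rightarrow>
     'm \<Rightarrow> 'x \<Rightarrow> ('m \<times> 'x) set" where
  "glob_class M X D \<alpha> m x = glob_rel M X D \<alpha> `` {(m, x)}"

definition glob_space ::
    "('m, 'b) monoid_scheme \<Rightarrow> 'x set \<Rightarrow> ('m \<Rightarrow> 'x set) \<Rightarrow> ('m \<Rightarrow> 'x \<Rightarrow> 'x) \<Rightarrow>
     ('m \<times> 'x) set set" where
  "glob_space M X D \<alpha> = (carrier M \<times> X) // glob_rel M X D \<alpha>"

text \<open>
  The monoid obtained from \<open>G\<close> by adjoining a zero: \<^const>\<open>None\<close> is the zero, and \<^const>\<open>Some\<close>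
  embeds \<open>G\<close>.
\<close>

definition adjoin_zero :: "('g, 'b) monoid_scheme \<Rightarrow> 'g option monoid" where
  "adjoin_zero G =
     \<lparr>carrier = insert None (Some ` carrier G),
      mult = (\<lambda>a b. case (a, b) of (Some g, Some h) \<Rightarrow> Some (g \<otimes>\<^bsub>G\<^esub> h) | _ \<Rightarrow> None),
      one = Some \<one>\<^bsub>G\<^esub>\<rparr>"

lemma monoid_adjoin_zero: "monoid G \<Longrightarrow> monoid (adjoin_zero G)"
  by (rule monoidI)
     (auto simp: adjoin_zero_def monoid.m_assoc monoid.m_closed monoid.one_closed
       monoid.l_one monoid.r_one split: option.splits)

end

theory Submission
  imports Defs
begin

text \<open>
  Since \<open>g 0 = 0 = 0 g\<close> in \<open>G\<^sup>0\<close>, the axioms of a strong partial action force every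
  \<open>\<alpha> g\<close> to be defined and to act as the identity on \<open>im (\<alpha> 0)\<close>, and force \<open>dom (\<alpha> 0)\<close> to be
  invariant in both directions under every \<open>\<alpha> g\<close>, with \<open>\<alpha> 0 \<circ> \<alpha> g = \<alpha> 0\<close>. Moreover
  \<open>\<alpha> g\<close> is invertible with inverse \<open>\<alpha> (inv g)\<close>. Hence each of the three sets in the statement is
  closed under steps of \<open>\<rightharpoonup>\<close> in both directions, and each of its elements is a single step
  to or from the representative.
\<close>

section \<open>Classes of the generated equivalence relation\<close>

lemma equivclp_closed:
  assumes "equivclp r p q" "p \<in> S"
    and "\<And>a b. r a b \<Longrightarrow> a \<in> S \<longleftrightarrow> b \<in> S"
  shows "q \<in> S"
  using assms(1,2) by (induction rule: equivclp_induct) (use assms(3) in blast)+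

text \<open>Invariance of \<open>S\<close> under a step in either direction bounds the class from
  above; links from \<open>(m, x)\<close> to all elements of \<open>S\<close> bound it from below.
  The inclusion in the carrier is asked for because \<open>equivclp\<close> lives on the whole type,
  while \<open>glob_rel\<close> is cut down to the carrier.\<close>

lemma glob_class_eqI:
  assumes "(m, x) \<in> S" "S \<subseteq> carrier M \<times> X"
    and "\<And>p q. glob_step M X D \<alpha> p q \<Longrightarrow> p \<in> S \<longleftrightarrow> q \<in> S"
    and "\<And>p. p \<in> S \<Longrightarrow> equivclp (glob_step M X D \<alpha>) (m, x) p"
  shows "glob_class M X D \<alpha> m x = S"
proof -
  have "q \<in> S" if "equivclp (glob_step M X D \<alpha>) (m, x) q" for q
    using that assms(1,3) by (rule equivclp_closed)
  with assms(1,2,4) show ?thesis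
    unfolding glob_class_def glob_rel_def by blast
qed

lemma glob_class_eq_of_step:
  assumes "glob_step M X D \<alpha> (m, x) (n, y)"
  shows "glob_class M X D \<alpha> m x = glob_class M X D \<alpha> n y"
proof -
  have "((m, x), (n, y)) \<in> glob_rel M X D \<alpha>"
    using assms r_into_equivclp[of "glob_step M X D \<alpha>", OF assms]
    unfolding glob_rel_def by (simp add: glob_step_def)
  then show ?thesis
    unfolding glob_class_def by (rule equiv_class_eq[OF equiv_glob_rel])
qed

lemma glob_space_eq_classes:
  "glob_space M X D \<alpha> = {glob_class M X D \<alpha> m x | m x. m \<in> carrier M \<and> x \<in> X}"
  by (auto simp: glob_space_def glob_class_def quotient_def)

section \<open>Multiplication in the group with zero\<close>

lemma adjoin_zero_simps [simp]:
  "None \<in> carrier (adjoin_zero G)"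
  "Some g \<in> carrier (adjoin_zero G) \<longleftrightarrow> g \<in> carrier G"
  "\<one>\<^bsub>adjoin_zero G\<^esub> = Some \<one>\<^bsub>G\<^esub>"
  "None \<otimes>\<^bsub>adjoin_zero G\<^esub> a = None"
  "a \<otimes>\<^bsub>adjoin_zero G\<^esub> None = None"
  "Some g \<otimes>\<^bsub>adjoin_zero G\<^esub> Some h = Some (g \<otimes>\<^bsub>G\<^esub> h)"
  by (auto simp: adjoin_zero_def split: option.splits)

lemma bex_carrier_adjoin_zero:
  "(\<exists>m\<in>carrier (adjoin_zero G). P m) \<longleftrightarrow> P None \<or> (\<exists>g\<in>carrier G. P (Some g))"
  by (auto simp: adjoin_zero_def)

section \<open>Consequences of the action axioms for a group with zero\<close>

locale group_zero_partial_action =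
  group G + act: strong_partial_action "adjoin_zero G" X D \<alpha>
  for G :: "('g, 'b) monoid_scheme" (structure)
    and X :: "'x set"
    and D :: "'g option \<Rightarrow> 'x set"
    and \<alpha> :: "'g option \<Rightarrow> 'x \<Rightarrow> 'x"
begin

abbreviation step :: "'g option \<times> 'x \<Rightarrow> 'g option \<times> 'x \<Rightarrow> bool" where
  "step \<equiv> glob_step (adjoin_zero G) X D \<alpha>"

abbreviation cls :: "'g option \<Rightarrow> 'x \<Rightarrow> ('g option \<times> 'x) set" where
  "cls \<equiv> glob_class (adjoin_zero G) X D \<alpha>"

lemma dom_closed: "m \<in> carrier (adjoin_zero G) \<Longrightarrow> x \<in> D m \<Longrightarrow> x \<in> X"
  using act.dom_subset by blast

lemma act_closed: "m \<in> carrier (adjoin_zero G) \<Longrightarrow> x \<in> D m \<Longrightarrow> \<alpha> m x \<in> X"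
  using act.maps_to by blast

lemma act_in_dom_iff:
  "m \<in> carrier (adjoin_zero G) \<Longrightarrow> n \<in> carrier (adjoin_zero G) \<Longrightarrow> x \<in> D m \<Longrightarrow>
    \<alpha> m x \<in> D n \<longleftrightarrow> x \<in> D (n \<otimes>\<^bsub>adjoin_zero G\<^esub> m)"
  using act.preimage_dom[of m n] by blast

lemma unit_dom [simp]: "D (Some \<one>) = X"
  using act.dom_one by simp

lemma unit_act [simp]: "x \<in> X \<Longrightarrow> \<alpha> (Some \<one>) x = x"
  using act.act_one by simp

text \<open>Because \<open>m\<close> times zero is zero, \<open>\<alpha> m\<close> is defined at
  \<open>\<alpha> None y\<close> as soon as \<open>\<alpha> None\<close> is defined at
  \<open>y\<close>, and the composite is \<open>\<alpha> None\<close> again.\<close>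

lemma zero_image_fixed:
  assumes "m \<in> carrier (adjoin_zero G)" "x \<in> \<alpha> None ` D None"
  shows "x \<in> D m" "\<alpha> m x = x"
proof -
  from assms(2) obtain y where y: "y \<in> D None" "x = \<alpha> None y" by blast
  with assms(1) show "x \<in> D m"
    using act_in_dom_iff[of None m y] by simp
  with assms(1) y show "\<alpha> m x = x"
    using act.act_mult[of None m y] by simp
qed

text \<open>This is the preimage axiom for the product of zero and \<open>m\<close>, which is
  zero.\<close>

lemma act_in_zero_dom_iff:
  "m \<in> carrier (adjoin_zero G) \<Longrightarrow> x \<in> D m \<Longrightarrow> \<alpha> m x \<in> D None \<longleftrightarrow> x \<in> D None"
  using act_in_dom_iff[of m None x] by simp

lemma zero_act_act:
  "m \<in> carrier (adjoin_zero G) \<Longrightarrow> x \<in> D m \<Longrightarrow> x \<in> D None \<Longrightarrow> \<alpha> None (\<alpha> m x) = \<alpha> None x"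
  using act.act_mult[of m None x] act_in_zero_dom_iff[of m x] by simp

lemma act_act:
  assumes "g \<in> carrier G" "h \<in> carrier G" "x \<in> D (Some g)" "\<alpha> (Some g) x \<in> D (Some h)"
  shows "x \<in> D (Some (h \<otimes> g))" "\<alpha> (Some (h \<otimes> g)) x = \<alpha> (Some h) (\<alpha> (Some g) x)"
  using assms act_in_dom_iff[of "Some g" "Some h" x] act.act_mult[of "Some g" "Some h" x] by simp_all

text \<open>The product of \<open>inv g\<close> and \<open>g\<close> is the unit, whose domain is
  all of \<open>X\<close>, so the preimage axiom imposes no condition beyond
  \<open>x \<in> D (Some g)\<close>.\<close>

lemma act_inv:
  assumes "g \<in> carrier G" "x \<in> D (Some g)"
  shows "\<alpha> (Some g) x \<in> D (Some (inv g))" "\<alpha> (Some (inv g)) (\<alpha> (Some g) x) = x"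
proof -
  have x: "x \<in> X" using assms dom_closed[of "Some g"] by simp
  then show *: "\<alpha> (Some g) x \<in> D (Some (inv g))"
    using assms act_in_dom_iff[of "Some g" "Some (inv g)" x] by simp
  show "\<alpha> (Some (inv g)) (\<alpha> (Some g) x) = x"
    using act_act(2)[of g "inv g" x] * assms x by simp
qed

lemma act_in_zero_image_iff:
  assumes "g \<in> carrier G" "x \<in> D (Some g)"
  shows "\<alpha> (Some g) x \<in> \<alpha> None ` D None \<longleftrightarrow> x \<in> \<alpha> None ` D None"
proof
  assume *: "\<alpha> (Some g) x \<in> \<alpha> None ` D None"
  \<comment> \<open>A point in the image of \<open>\<alpha> None\<close> is fixed by
    \<open>inv g\<close>; since \<open>inv g\<close> also sends this one back to \<open>x\<close>,
    the two points coincide.\<close>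
  have "\<alpha> (Some (inv g)) (\<alpha> (Some g) x) = \<alpha> (Some g) x"
    using * assms(1) by (intro zero_image_fixed(2)) simp_all
  with * show "x \<in> \<alpha> None ` D None"
    using act_inv(2)[OF assms] by simp
next
  assume "x \<in> \<alpha> None ` D None"
  with assms(1) show "\<alpha> (Some g) x \<in> \<alpha> None ` D None"
    using zero_image_fixed(2)[of "Some g" x] by simp
qed

section \<open>Steps sorted by their first components\<close>

lemma mult_eq_iff_left:
  assumes "g \<in> carrier G" "h \<in> carrier G" "k \<in> carrier G"
  shows "g = h \<otimes> k \<longleftrightarrow> k = inv h \<otimes> g"
  using assms inv_solve_left[of k h g] by simp

lemma mult_inv_cancel: "h \<in> carrier G \<Longrightarrow> g \<in> carrier G \<Longrightarrow> h \<otimes> (inv h \<otimes> g) = g"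
  by (simp flip: m_assoc)

text \<open>The factor \<open>k\<close> cannot be zero, as the product would then be zero, and
  cancellation in \<open>G\<close> leaves only \<open>inv h \<otimes> g\<close>.\<close>

lemma step_Some_Some:
  "step (Some g, x) (Some h, y) \<longleftrightarrow>
    g \<in> carrier G \<and> h \<in> carrier G \<and> x \<in> D (Some (inv h \<otimes> g)) \<and> y = \<alpha> (Some (inv h \<otimes> g)) x"
    (is "_ \<longleftrightarrow> ?R")
proof
  assume "step (Some g, x) (Some h, y)"
  then obtain k where g: "g \<in> carrier G" "h \<in> carrier G"
    and k: "k \<in> carrier G" "g = h \<otimes> k" "x \<in> D (Some k)" "y = \<alpha> (Some k) x"
    by (auto simp: glob_step_def bex_carrier_adjoin_zero)
  have "k = inv h \<otimes> g"
    using g k(1,2) mult_eq_iff_left by blast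
  with g k(3,4) show ?R by blast
next
  assume ?R
  then show "step (Some g, x) (Some h, y)"
    using dom_closed[of "Some (inv h \<otimes> g)" x] act_closed[of "Some (inv h \<otimes> g)" x]
    by (auto simp: glob_step_def bex_carrier_adjoin_zero mult_inv_cancel
        intro!: bexI[of _ "inv h \<otimes> g"])
qed

lemma step_Some_None: "\<not> step (Some g, x) (None, y)"
  by (simp add: glob_step_def)

text \<open>A product with left factor \<open>Some h\<close> is zero only if the other factor is
  zero, so the step must be made by \<open>\<alpha> None\<close>.\<close>

lemma step_None_Some:
  "step (None, x) (Some h, y) \<longleftrightarrow> h \<in> carrier G \<and> x \<in> D None \<and> y = \<alpha> None x"
  using dom_closed[of None x] act_closed[of None x]
  by (auto simp: glob_step_def bex_carrier_adjoin_zero)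

lemma step_None_None:
  "step (None, x) (None, y) \<longleftrightarrow> (\<exists>k\<in>carrier (adjoin_zero G). x \<in> D k \<and> y = \<alpha> k x)"
  using dom_closed act_closed by (auto simp: glob_step_def)

text \<open>The product of \<open>inv k \<otimes> h\<close> and \<open>inv h \<otimes> g\<close>
  telescopes to \<open>inv k \<otimes> g\<close>. With symmetry, this makes any chain of steps
  inside the copy of \<open>G\<close> collapse to a single step.\<close>

lemma step_Some_trans:
  assumes "step (Some g, x) (Some h, y)" "step (Some h, y) (Some k, z)"
  shows "step (Some g, x) (Some k, z)"
proof -
  have g: "g \<in> carrier G" "h \<in> carrier G" "k \<in> carrier G"
    using assms by (simp_all add: step_Some_Some)
  then have eq: "(inv k \<otimes> h) \<otimes> (inv h \<otimes> g) = inv k \<otimes> g"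
    by (simp add: m_assoc mult_inv_cancel)
  have y: "x \<in> D (Some (inv h \<otimes> g))" "y = \<alpha> (Some (inv h \<otimes> g)) x"
    using assms(1) unfolding step_Some_Some by blast+
  have z: "y \<in> D (Some (inv k \<otimes> h))" "z = \<alpha> (Some (inv k \<otimes> h)) y"
    using assms(2) unfolding step_Some_Some by blast+
  show ?thesis
    unfolding step_Some_Some z(2) y(2)
    using g act_act[OF _ _ y(1) z(1)[unfolded y(2)], unfolded eq] by simp
qed

lemma step_Some_sym:
  assumes "step (Some g, x) (Some h, y)"
  shows "step (Some h, y) (Some g, x)"
proof -
  have g: "g \<in> carrier G" "h \<in> carrier G"
    using assms by (simp_all add: step_Some_Some)
  then have eq: "inv (inv h \<otimes> g) = inv g \<otimes> h"
    by (simp add: inv_mult_group)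
  have y: "x \<in> D (Some (inv h \<otimes> g))" "y = \<alpha> (Some (inv h \<otimes> g)) x"
    using assms unfolding step_Some_Some by blast+
  from g have "inv h \<otimes> g \<in> carrier G" by simp
  from act_inv[OF this y(1), unfolded eq, folded y(2)] g show ?thesis
    unfolding step_Some_Some by simp
qed

text \<open>Translating by \<open>k\<close> or \<open>inv k\<close> moves between the two witnesses.
  This handles steps by group elements between pairs whose first component is zero.\<close>

lemma translates_closed:
  assumes "x \<in> X" "k \<in> carrier G" "z \<in> D (Some k)"
  shows "(\<exists>g\<in>carrier G. x \<in> D (Some g) \<and> \<alpha> (Some k) z = \<alpha> (Some g) x) \<longleftrightarrow>
    (\<exists>g\<in>carrier G. x \<in> D (Some g) \<and> z = \<alpha> (Some g) x)"
proof
  assume "\<exists>g\<in>carrier G. x \<in> D (Some g) \<and> \<alpha> (Some k) z = \<alpha> (Some g) x"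
  then obtain g where g: "g \<in> carrier G" "x \<in> D (Some g)" "\<alpha> (Some k) z = \<alpha> (Some g) x"
    by blast
  \<comment> \<open>As \<open>\<alpha> (Some g) x\<close> equals \<open>\<alpha> (Some k) z\<close>,
    the map of \<open>inv k\<close> is defined there and returns \<open>z\<close>.\<close>
  have "x \<in> D (Some (inv k \<otimes> g)) \<and> z = \<alpha> (Some (inv k \<otimes> g)) x"
    using act_act[of g "inv k" x] act_inv[OF assms(2,3)] assms(2) g by simp
  then show "\<exists>g\<in>carrier G. x \<in> D (Some g) \<and> z = \<alpha> (Some g) x"
    using assms(2) g(1) by blast
next
  assume "\<exists>g\<in>carrier G. x \<in> D (Some g) \<and> z = \<alpha> (Some g) x"
  then obtain g where "g \<in> carrier G" "x \<in> D (Some g)" "z = \<alpha> (Some g) x"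
    by blast
  with assms(2,3) show "\<exists>g\<in>carrier G. x \<in> D (Some g) \<and> \<alpha> (Some k) z = \<alpha> (Some g) x"
    using act_act[of g k x] by (intro bexI[of _ "k \<otimes> g"]) simp_all
qed

section \<open>Computation of the three kinds of classes\<close>

lemma cls_None:
  assumes x: "x \<in> X" "x \<notin> D None"
  shows "cls None x = {(None, \<alpha> (Some g) x) | g. g \<in> carrier G \<and> x \<in> D (Some g)}"
    (is "_ = ?S")
proof (rule glob_class_eqI)
  show "(None, x) \<in> ?S"
    using x by (auto intro!: exI[of _ \<one>])
  show "?S \<subseteq> carrier (adjoin_zero G) \<times> X"
    by (auto intro: act_closed)
  \<comment> \<open>Invariance of \<open>D None\<close> keeps all translates of \<open>x\<close>
    outside it; this rules out both steps by zero and steps into the copy of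
    \<open>G\<close>.\<close>
  have not_zero: "z \<notin> D None" if "(None, z) \<in> ?S" for z
    using that x act_in_zero_dom_iff by auto
  have mem: "(None, z) \<in> ?S \<longleftrightarrow> (\<exists>g\<in>carrier G. x \<in> D (Some g) \<and> z = \<alpha> (Some g) x)" for z
    by auto
  fix p q assume *: "step p q"
  obtain m y n z where pq: "p = (m, y)" "q = (n, z)" by force
  show "p \<in> ?S \<longleftrightarrow> q \<in> ?S"
  proof (cases m; cases n)
    assume mn: "m = None" "n = None"
    then obtain k where k: "k \<in> carrier (adjoin_zero G)" "y \<in> D k" "z = \<alpha> k y"
      using * pq by (auto simp: step_None_None)
    show ?thesis
    proof (cases k)
      case None
      \<comment> \<open>Both ends of a step by zero lie in \<open>D None\<close>: the target does
        because the image of \<open>\<alpha> None\<close> is contained in its domain. Hence neither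
        end is in the set.\<close>
      then have "y \<in> D None" "z \<in> D None"
        using k zero_image_fixed(1)[of None z] by auto
      then show ?thesis
        unfolding pq mn using not_zero by blast
    next
      case (Some h)
      then show ?thesis
        unfolding pq mn mem using k translates_closed[OF x(1), of h y] by simp
    qed
  next
    fix h assume mn: "m = None" "n = Some h"
    then have "y \<in> D None"
      using * pq by (auto simp: step_None_Some)
    then show ?thesis
      unfolding pq mn using not_zero by blast
  qed (use * pq in \<open>auto simp: step_Some_None\<close>)
next
  fix p assume "p \<in> ?S"
  then have "step (None, x) p"
    by (force simp: step_None_None bex_carrier_adjoin_zero)
  then show "equivclp step (None, x) p" by (rule r_into_equivclp)
qed

text \<open>The set consists of the targets of single steps from \<open>(Some g, x)\<close> within
  the copy of \<open>G\<close>. The only other steps touching that copy come from zero and land in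
  the image of \<open>\<alpha> None\<close>, which the translates of \<open>x\<close> avoid.\<close>

lemma cls_Some:
  assumes gx: "g \<in> carrier G" "x \<in> X" "x \<notin> \<alpha> None ` D None"
  shows "cls (Some g) x =
    {(Some h, y) | h y. h \<in> carrier G \<and> x \<in> D (Some (inv h \<otimes> g)) \<and>
      \<alpha> (Some (inv h \<otimes> g)) x = y}"
    (is "_ = ?S")
proof (rule glob_class_eqI)
  show "(Some g, x) \<in> ?S"
    using gx by simp
  show "?S \<subseteq> carrier (adjoin_zero G) \<times> X"
    using gx by (auto intro: act_closed)
  have not_im: "z \<notin> \<alpha> None ` D None" if "(Some h, z) \<in> ?S" for h z
    using that gx act_in_zero_image_iff[of "inv h \<otimes> g" x] by auto
  have mem: "(Some h, z) \<in> ?S \<longleftrightarrow> step (Some g, x) (Some h, z)" for h z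
    using gx by (auto simp: step_Some_Some)
  fix p q assume *: "step p q"
  obtain m y n z where pq: "p = (m, y)" "q = (n, z)" by force
  show "p \<in> ?S \<longleftrightarrow> q \<in> ?S"
  proof (cases m; cases n)
    fix h k assume mn: "m = Some h" "n = Some k"
    then show ?thesis
      using * unfolding pq mn mem by (blast intro: step_Some_trans step_Some_sym)
  next
    fix h assume mn: "m = None" "n = Some h"
    then have "z \<in> \<alpha> None ` D None"
      using * pq by (auto simp: step_None_Some)
    then show ?thesis
      unfolding pq mn using not_im by blast
  qed (use * pq in \<open>auto simp: step_Some_None\<close>)
next
  fix p assume "p \<in> ?S"
  then have "step (Some g, x) p"
    using gx by (auto simp: step_Some_Some)
  then show "equivclp step (Some g, x) p" by (rule r_into_equivclp)
qed

lemma cls_Some_zero_image: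
  assumes gx: "g \<in> carrier G" "x \<in> \<alpha> None ` D None"
  shows "cls (Some g) x =
    (Some ` carrier G) \<times> {x} \<union> {None} \<times> {y \<in> D None. \<alpha> None y = x}"
    (is "_ = ?S")
proof (rule glob_class_eqI)
  have x: "x \<in> X"
    using gx by (auto intro: act_closed)
  show "(Some g, x) \<in> ?S"
    using gx by simp
  show "?S \<subseteq> carrier (adjoin_zero G) \<times> X"
    using x dom_closed[of None] by auto
  fix p q assume *: "step p q"
  obtain m y n z where pq: "p = (m, y)" "q = (n, z)" by force
  show "p \<in> ?S \<longleftrightarrow> q \<in> ?S"
  proof (cases m; cases n)
    fix h k assume mn: "m = Some h" "n = Some k"
    have hk: "h \<in> carrier G" "k \<in> carrier G" "y \<in> D (Some (inv k \<otimes> h))"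
        "z = \<alpha> (Some (inv k \<otimes> h)) y"
      using * unfolding pq mn step_Some_Some by auto
    \<comment> \<open>If one end lies in the image of \<open>\<alpha> None\<close>, so does the
      other, and there every group element acts as the identity.\<close>
    have "z = y" if "y \<in> \<alpha> None ` D None \<or> z \<in> \<alpha> None ` D None"
      using that hk act_in_zero_image_iff[of "inv k \<otimes> h" y]
        zero_image_fixed(2)[of "Some (inv k \<otimes> h)" y] by auto
    then show ?thesis
      unfolding pq mn using hk(1,2) gx(2) by auto
  next
    fix h assume mn: "m = None" "n = Some h"
    then show ?thesis
      using * pq by (auto simp: step_None_Some)
  next
    assume mn: "m = None" "n = None"
    then obtain k where k: "k \<in> carrier (adjoin_zero G)" "y \<in> D k" "z = \<alpha> k y"
      using * pq by (auto simp: step_None_None)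
    then show ?thesis
      \<comment> \<open>A step between zero pairs preserves both membership in \<open>D None\<close>
        and the value of \<open>\<alpha> None\<close>.\<close>
      unfolding pq mn using act_in_zero_dom_iff[of k y] zero_act_act[of k y] by auto
  qed (use * pq in \<open>auto simp: step_Some_None\<close>)
next
  fix p assume p: "p \<in> ?S"
  \<comment> \<open>Pairs over \<open>G\<close> are reached from the representative by a step that
    fixes \<open>x\<close>; pairs over zero step to the representative through
    \<open>\<alpha> None\<close>.\<close>
  have "step (Some g, x) p \<or> step p (Some g, x)"
    using p gx(1) zero_image_fixed[OF _ gx(2)] by (auto simp: step_Some_Some step_None_Some)
  then show "equivclp step (Some g, x) p"
    by (blast intro: equivclp_sym)
qed

text \<open>Representatives \<open>(None, x)\<close> with \<open>x \<in> D None\<close> are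
  redundant: a step by zero identifies them with
  \<open>(Some \<one>, \<alpha> None x)\<close>.\<close>

lemma glob_space_eq:
  "glob_space (adjoin_zero G) X D \<alpha> =
    {cls None x | x. x \<in> X \<and> x \<notin> D None} \<union>
    {cls (Some g) x | g x. g \<in> carrier G \<and> x \<in> X \<and> x \<notin> \<alpha> None ` D None} \<union>
    {cls (Some g) x | g x. g \<in> carrier G \<and> x \<in> \<alpha> None ` D None}"
proof -
  define I where "I = \<alpha> None ` D None"
  define R where "R = {cls None x | x. x \<in> X \<and> x \<notin> D None} \<union>
    {cls (Some g) x | g x. g \<in> carrier G \<and> x \<in> X \<and> x \<notin> I} \<union>
    {cls (Some g) x | g x. g \<in> carrier G \<and> x \<in> I}"
  have I: "x \<in> X" if "x \<in> I" for x
    using that zero_image_fixed(1)[of "Some \<one>" x] unfolding I_def by simp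
  have cls_unit: "cls (Some g) x \<in> R" if "g \<in> carrier G" "x \<in> X" for g x
    using that unfolding R_def by blast
  have cls_zero: "cls None x \<in> R" if "x \<in> X" for x
  proof (cases "x \<in> D None")
    case True
    then have "cls None x = cls (Some \<one>) (\<alpha> None x)"
      by (intro glob_class_eq_of_step) (simp add: step_None_Some)
    also have "\<dots> \<in> R"
      using True by (intro cls_unit act_closed) simp_all
    finally show ?thesis .
  qed (use that in \<open>unfold R_def, blast\<close>)
  have "cls m x \<in> R" if "m \<in> carrier (adjoin_zero G)" "x \<in> X" for m x
    using that cls_unit cls_zero by (cases m) simp_all
  then have "glob_space (adjoin_zero G) X D \<alpha> \<subseteq> R"
    unfolding glob_space_eq_classes by blast
  moreover have cls_in: "cls m x \<in> glob_space (adjoin_zero G) X D \<alpha>"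
    if "m \<in> carrier (adjoin_zero G)" "x \<in> X" for m x
    using that unfolding glob_space_eq_classes by blast
  have "R \<subseteq> glob_space (adjoin_zero G) X D \<alpha>"
    unfolding R_def by (auto intro: I cls_in)
  ultimately show ?thesis
    unfolding R_def I_def by (rule equalityI)
qed

end

theorem proposition3p9:
  fixes G :: "('g, 'b) monoid_scheme"
    and X :: "('x, 'c) monoid_scheme"
    and D :: "'g option \<Rightarrow> 'x set"
    and \<alpha> :: "'g option \<Rightarrow> 'x \<Rightarrow> 'x"
  assumes "group G"
    and "semigroup_strong_partial_action (adjoin_zero G) X D \<alpha>"
  shows "let cls = glob_class (adjoin_zero G) (carrier X) D \<alpha> in
         glob_space (adjoin_zero G) (carrier X) D \<alpha> =
           {cls None x | x. x \<in> carrier X \<and> x \<notin> D None} \<union>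
           {cls (Some g) x | g x. g \<in> carrier G \<and> x \<in> carrier X \<and> x \<notin> \<alpha> None ` D None} \<union>
           {cls (Some g) x | g x. g \<in> carrier G \<and> x \<in> \<alpha> None ` D None} \<and>
         (\<forall>x\<in>carrier X. x \<notin> D None \<longrightarrow>
           cls None x = {(None, \<alpha> (Some g) x) | g. g \<in> carrier G \<and> x \<in> D (Some g)}) \<and>
         (\<forall>g\<in>carrier G. \<forall>x\<in>carrier X. x \<notin> \<alpha> None ` D None \<longrightarrow>
           cls (Some g) x =
             {(Some h, y) | h y. h \<in> carrier G \<and> x \<in> D (Some (inv\<^bsub>G\<^esub> h \<otimes>\<^bsub>G\<^esub> g)) \<and>
                                 \<alpha> (Some (inv\<^bsub>G\<^esub> h \<otimes>\<^bsub>G\<^esub> g)) x = y}) \<and>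
         (\<forall>g\<in>carrier G. \<forall>x\<in>\<alpha> None ` D None.
           cls (Some g) x =
             (Some ` carrier G) \<times> {x} \<union> {None} \<times> {y \<in> D None. \<alpha> None y = x})"
proof -
  interpret group G by fact
  interpret semigroup_strong_partial_action "adjoin_zero G" X D \<alpha> by fact
  interpret group_zero_partial_action G "carrier X" D \<alpha> ..
  show ?thesis
    unfolding Let_def
    using glob_space_eq cls_None cls_Some cls_Some_zero_image by (intro conjI ballI impI)
qed

end
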